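(* Let $n$ be a positive even integer and let $k=n/2$. Then $$\mathrm{La}(n,\mathcal{N}) \geq \binom{n}{k}+A(n,4,k).$$
   Context: Let $[n]=\{1,\ldots,n\}$. The $n$-dimensional Boolean lattice $\mathcal{B}_n$ is the partially ordered set $(2^{[n]},\subseteq)$ of all subsets of $[n]$ ordered by inclusion. A family $\mathcal{F}\subseteq 2^{[n]}$ is regarded as a poset under inclusion. A poset $(P',\leq')$ is a (weak) subposet of a poset $(P,\leq)$ if there is an injection $f:P'\to P$ such that $u\leq' v$ in $P'$ implies $f(u)\leq f(v)$ in $P$ (the converse implication is not required). A family $\mathcal{F}$ is $P'$-free if it does not contain $P'$ as a weak subposet. The poset $\mathcal{N}$ has four distinct elements $W,X,Y,Z$ with relations $W<X$, $Y<X$, $Y<Z$ (and no other strict relations). Thus a family $\mathcal{F}\subseteq 2^{[n]}$ is $\mathcal{N}$-free exactly when there are no four distinct sets $W,X,Y,Z\in\mathcal{F}$ with $W\subset X$, $Y\subset X$ and $Y\subset Z$ (other inclusions among the four sets being allowed). $\mathrm{La}(n,\mathcal{N})$ denotes the maximum size of an $\mathcal{N}$-free family $\mathcal{F}\subseteq 2^{[n]}$. $A(n,2\delta,k)$ denotes the maximum size of a family of subsets of $[n]$, each of size exactly $k$, such that any two distinct members $S,T$ of the family satisfy $|S\bigtriangleup T|\geq 2\delta$ (equivalently, the maximum number of $\{0,1\}$-vectors of length $n$ with exactly $k$ ones each and pairwise Hamming distance at least $2\delta$). In particular, $A(n,4,k)$ is the case $\delta=2$. *)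

theory Defs
  imports Complex_Main
begin

text \<open>Posets are given by a carrier set together with a (reflexive) order predicate.\<close>

definition weak_subposet ::
    "'a set \<Rightarrow> ('a \<Rightarrow> 'a \<Rightarrow> bool) \<Rightarrow> 'b set \<Rightarrow> ('b \<Rightarrow> 'b \<Rightarrow> bool) \<Rightarrow> bool" where
  "weak_subposet P' le' P le \<longleftrightarrow>
     (\<exists>f. inj_on f P' \<and> f ` P' \<subseteq> P \<and> monotone_on P' le' le f)"

definition poset_free :: "'a set \<Rightarrow> ('a \<Rightarrow> 'a \<Rightarrow> bool) \<Rightarrow> nat set set \<Rightarrow> bool" where
  "poset_free P' le' F \<longleftrightarrow> \<not> weak_subposet P' le' F (\<subseteq>)"

text \<open>
  For an empty \<open>P'\<close> no family is \<open>P'\<close>-free and \<open>Max\<close> is applied to the empty set; for every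
  nonempty \<open>P'\<close> the set of sizes is finite and contains 0.
\<close>

definition La :: "nat \<Rightarrow> 'a set \<Rightarrow> ('a \<Rightarrow> 'a \<Rightarrow> bool) \<Rightarrow> nat" where
  "La n P' le' = Max (card ` {F. F \<subseteq> Pow {1..n} \<and> poset_free P' le' F})"

datatype N_elem = W_N | X_N | Y_N | Z_N

definition N_le :: "N_elem \<Rightarrow> N_elem \<Rightarrow> bool" where
  "N_le u v \<longleftrightarrow> u = v \<or> (u, v) \<in> {(W_N, X_N), (Y_N, X_N), (Y_N, Z_N)}"

abbreviation La_N :: "nat \<Rightarrow> nat" where
  "La_N n \<equiv> La n (UNIV :: N_elem set) N_le"

text \<open>The argument \<open>d\<close> is the minimum distance itself, i.e. the middle argument of \<open>A(n,2\<delta>,k)\<close>.\<close>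

definition const_weight_code :: "nat \<Rightarrow> nat \<Rightarrow> nat \<Rightarrow> nat set set \<Rightarrow> bool" where
  "const_weight_code n d k C \<longleftrightarrow>
     C \<subseteq> {S. S \<subseteq> {1..n} \<and> card S = k} \<and> pairwise (\<lambda>S T. d \<le> card (sym_diff S T)) C"

definition max_code_size :: "nat \<Rightarrow> nat \<Rightarrow> nat \<Rightarrow> nat" where
  "max_code_size n d k = Max (card ` {C. const_weight_code n d k C})"


lemma N_le_order: "partial_order_on UNIV {(u, v). N_le u v}"
  by (auto simp: partial_order_on_def preorder_on_def refl_on_def trans_def antisym_def N_le_def)

lemma N_free_iff:
  "poset_free UNIV N_le F \<longleftrightarrow>
     \<not> (\<exists>W\<in>F. \<exists>X\<in>F. \<exists>Y\<in>F. \<exists>Z\<in>F. distinct [W, X, Y, Z] \<and> W \<subset> X \<and> Y \<subset> X \<and> Y \<subset> Z)"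
  (is "_ \<longleftrightarrow> \<not> ?R")
proof -
  have "weak_subposet UNIV N_le F (\<subseteq>)" if R: ?R
  proof -
    obtain W X Y Z where *: "W \<in> F" "X \<in> F" "Y \<in> F" "Z \<in> F" "distinct [W, X, Y, Z]"
      "W \<subset> X" "Y \<subset> X" "Y \<subset> Z"
      using R by blast
    define f where "f = case_N_elem W X Y Z"
    have "inj f"
      using *(5) by (auto simp: inj_def f_def split: N_elem.splits)
    moreover have "range f \<subseteq> F"
      using * by (auto simp: f_def split: N_elem.splits)
    moreover have "monotone_on UNIV N_le (\<subseteq>) f"
      using * by (auto simp: monotone_on_def N_le_def f_def)
    ultimately show ?thesis
      unfolding weak_subposet_def by blast
  qed
  moreover have ?R if wk: "weak_subposet UNIV N_le F (\<subseteq>)"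
  proof -
    obtain f where f: "inj f" "range f \<subseteq> F" "monotone_on UNIV N_le (\<subseteq>) f"
      using wk unfolding weak_subposet_def by blast
    have "distinct [f W_N, f X_N, f Y_N, f Z_N]"
      using f(1) by (auto dest: injD)
    moreover have "f W_N \<subseteq> f X_N" "f Y_N \<subseteq> f X_N" "f Y_N \<subseteq> f Z_N"
      using f(3) by (auto simp: monotone_on_def N_le_def)
    ultimately have "distinct [f W_N, f X_N, f Y_N, f Z_N] \<and> f W_N \<subset> f X_N \<and> f Y_N \<subset> f X_N \<and> f Y_N \<subset> f Z_N"
      by auto
    moreover have "f u \<in> F" for u
      using f(2) by blast
    ultimately show ?R
      by blast
  qed
  ultimately show ?thesis
    unfolding poset_free_def by blast
qed

lemma La_set_finite_nonempty:
  assumes "P' \<noteq> {}"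
  shows "finite (card ` {F. F \<subseteq> Pow {1..n} \<and> poset_free P' le' F})"
    and "card ` {F. F \<subseteq> Pow {1..n} \<and> poset_free P' le' F} \<noteq> {}"
proof -
  have "finite (Pow (Pow {1..n}))"
    by simp
  then have "finite {F. F \<subseteq> Pow {1..n} \<and> poset_free P' le' F}"
    by (rule rev_finite_subset) auto
  then show "finite (card ` {F. F \<subseteq> Pow {1..n} \<and> poset_free P' le' F})"
    by (rule finite_imageI)
  have "poset_free P' le' {}"
    using assms by (auto simp: poset_free_def weak_subposet_def)
  then show "card ` {F. F \<subseteq> Pow {1..n} \<and> poset_free P' le' F} \<noteq> {}"
    by blast
qed

lemma code_set_finite_nonempty:
  "finite (card ` {C. const_weight_code n d k C})" "card ` {C. const_weight_code n d k C} \<noteq> {}"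
proof -
  have "finite (Pow (Pow {1..n}))"
    by simp
  then have "finite {C. const_weight_code n d k C}"
    by (rule rev_finite_subset) (auto simp: const_weight_code_def)
  then show "finite (card ` {C. const_weight_code n d k C})"
    by (rule finite_imageI)
  have "const_weight_code n d k {}"
    by (simp add: const_weight_code_def)
  then show "card ` {C. const_weight_code n d k C} \<noteq> {}"
    by blast
qed

end

theory Submission
  imports Defs
begin

text \<open>
  Take the whole level \<open>k\<close> and, for every codeword \<open>c\<close>, add \<open>c \<triangle> {n}\<close>, which lies on level
  \<open>k - 1\<close> or \<open>k + 1\<close>. The added sets are again pairwise at distance at least \<open>4\<close>, so no two of
  them are comparable and no set of level \<open>k\<close> is at distance \<open>1\<close> from two of them. Hence
  every comparable pair consists of a set of level \<open>k\<close> and an added set at distance \<open>1\<close>. A copy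
  of \<open>N\<close> is a path with four vertices, so one of its two inner vertices lies on level \<open>k\<close>
  and has two added neighbours, which is impossible.
\<close>

text \<open>An element that separates \<open>A\<close> from \<open>C\<close> separates
  \<open>A\<close> from \<open>B\<close> or \<open>B\<close> from \<open>C\<close>.\<close>

lemma card_sym_diff_triangle:
  assumes "finite A" "finite B" "finite C"
  shows "card (sym_diff A C) \<le> card (sym_diff A B) + card (sym_diff B C)"
proof -
  have "card (sym_diff A C) \<le> card (sym_diff A B \<union> sym_diff B C)"
    using assms by (intro card_mono) auto
  also have "\<dots> \<le> card (sym_diff A B) + card (sym_diff B C)"
    by (rule card_Un_le)
  finally show ?thesis .
qed

lemma card_sym_diff_subset:
  assumes "A \<subseteq> B" "finite B"
  shows "card (sym_diff A B) = card B - card A"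
proof -
  have "sym_diff A B = B - A"
    using assms(1) by blast
  then show ?thesis
    using assms by (simp add: card_Diff_subset finite_subset)
qed

lemma N_free_level_Un_code:
  assumes fin: "\<And>A. A \<in> G \<Longrightarrow> finite A"
    and near: "\<And>A. A \<in> G \<Longrightarrow> card A = Suc k \<or> Suc (card A) = k"
    and dist: "pairwise (\<lambda>S T. 4 \<le> card (sym_diff S T)) G"
    and L: "\<And>A. A \<in> L \<Longrightarrow> finite A \<and> card A = k"
  shows "poset_free UNIV N_le (L \<union> G)"
proof -
  have sub: "(A \<in> L \<and> B \<in> G \<or> A \<in> G \<and> B \<in> L) \<and> card (sym_diff A B) = 1"
    if "A \<in> L \<union> G" "B \<in> L \<union> G" "A \<subset> B" for A B
  proof -
    have finB: "finite B"
      using that fin L by blast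
    have sd: "card (sym_diff A B) = card B - card A"
      using that finB by (intro card_sym_diff_subset) auto
    have lt: "card A < card B"
      using that finB by (simp add: psubset_card_mono)
    \<comment> \<open>Sizes in \<open>G\<close> differ by at most 2, and for nested sets the size
      difference is the distance.\<close>
    have "\<not> (A \<in> G \<and> B \<in> G)"
    proof
      assume AB: "A \<in> G \<and> B \<in> G"
      then have "4 \<le> card (sym_diff A B)"
        using pairwiseD[OF dist, of A B] that(3) by blast
      then have "4 \<le> card B - card A"
        unfolding sd .
      then show False
        using near[of A] near[of B] AB by linarith
    qed
    \<comment> \<open>Sets of \<open>L\<close> have equal size, so one set comes from each family
      and the sizes differ by exactly 1.\<close>
    then show ?thesis
      using that(1,2) sd lt near[of A] near[of B] L[of A] L[of B] by auto
  qed
  \<comment> \<open>The detour through \<open>B\<close> bounds the distance of \<open>A\<close> and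
    \<open>C\<close> by 2.\<close>
  have no_cherry: False
    if "A \<in> G" "B \<in> L" "C \<in> G" "A \<noteq> C" "card (sym_diff A B) = 1" "card (sym_diff B C) = 1"
    for A B C
  proof -
    have "4 \<le> card (sym_diff A C)"
      using pairwiseD[OF dist, of A C] that(1,3,4) by blast
    moreover have "card (sym_diff A C) \<le> card (sym_diff A B) + card (sym_diff B C)"
      using that fin L by (intro card_sym_diff_triangle) auto
    ultimately show False
      using that by simp
  qed
  have disj: "A \<notin> G" if "A \<in> L" for A
    using near[of A] L[OF that] by auto
  show ?thesis
    unfolding N_free_iff
  proof (intro notI, elim bexE conjE)
    fix W X Y Z
    assume F: "W \<in> L \<union> G" "X \<in> L \<union> G" "Y \<in> L \<union> G" "Z \<in> L \<union> G"
      and d: "distinct [W, X, Y, Z]" and lt: "W \<subset> X" "Y \<subset> X" "Y \<subset> Z"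
    note s = sub[OF F(1,2) lt(1)] sub[OF F(3,2) lt(2)] sub[OF F(3,4) lt(3)]
    show False
    \<comment> \<open>Along the path \<open>W\<close>, \<open>X\<close>, \<open>Y\<close>,
      \<open>Z\<close> the families alternate: \<open>X\<close> is the centre of the cherry if it is
      in \<open>L\<close>, otherwise \<open>Y\<close> is.\<close>
    proof (cases "X \<in> L")
      case True
      then have "W \<in> G" "Y \<in> G"
        using s disj by auto
      then show False
        using no_cherry[of W X Y] True d s by (auto simp: Un_commute)
    next
      case False
      then have "X \<in> G" "Y \<in> L" "Z \<in> G"
        using s disj by auto
      then show False
        using no_cherry[of X Y Z] d s by (auto simp: Un_commute)
    qed
  qed
qed

lemma La_N_ge_card:
  assumes "F \<subseteq> Pow {1..n}" "poset_free UNIV N_le F"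
  shows "card F \<le> La_N n"
  unfolding La_def using assms by (intro Max_ge La_set_finite_nonempty) auto

lemma La_N_ge_level_plus_code:
  assumes "n > 0"
  shows "(n choose k) + max_code_size n 4 k \<le> La_N n"
proof -
  have "max_code_size n 4 k \<in> card ` {C. const_weight_code n 4 k C}"
    unfolding max_code_size_def by (intro Max_in code_set_finite_nonempty)
  then obtain C where C: "const_weight_code n 4 k C" and cardC: "max_code_size n 4 k = card C"
    by auto
  \<comment> \<open>Toggling one fixed element preserves all symmetric differences, so
    \<open>g\<close> keeps distances and is injective, and it moves each set by exactly one
    level.\<close>
  define g where "g c = sym_diff c {n}" for c :: "nat set"
  define L where "L = {S. S \<subseteq> {1..n} \<and> card S = k}"
  have CL: "C \<subseteq> L" and distC: "pairwise (\<lambda>S T. 4 \<le> card (sym_diff S T)) C"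
    using C by (auto simp: const_weight_code_def L_def)
  have finL: "finite S" if "S \<in> L" for S
    using that by (auto simp: L_def intro: finite_subset)
  have sd_g: "sym_diff (g c) (g d) = sym_diff c d" for c d
    by (auto simp: g_def)
  have "inj g"
    using sd_g by (intro injI) blast
  have near: "card A = Suc k \<or> Suc (card A) = k" if A: "A \<in> g ` C" for A
  proof -
    obtain c where c: "c \<in> L" "A = g c"
      using A CL by blast
    have "g c = (if n \<in> c then c - {n} else insert n c)"
      by (auto simp: g_def)
    then show ?thesis
      using c finL[OF c(1)] card_Suc_Diff1[of c n] by (auto simp: L_def)
  qed
  have finG: "finite A" if "A \<in> g ` C" for A
    using that CL finL by (auto simp: g_def)
  have distG: "pairwise (\<lambda>S T. 4 \<le> card (sym_diff S T)) (g ` C)"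
    unfolding pairwise_image sd_g using distC by (rule pairwise_mono) auto
  have levelL: "finite S \<and> card S = k" if "S \<in> L" for S
    using that finL[OF that] by (simp add: L_def)
  have free: "poset_free UNIV N_le (L \<union> g ` C)"
    by (rule N_free_level_Un_code[OF finG near distG levelL])
  \<comment> \<open>Since \<open>n > 0\<close>, the toggled element \<open>n\<close> belongs to the
    ground set.\<close>
  have "L \<union> g ` C \<subseteq> Pow {1..n}"
    using CL assms by (auto simp: L_def g_def)
  then have le: "card (L \<union> g ` C) \<le> La_N n"
    using free by (rule La_N_ge_card)
  have "finite L"
    by (simp add: L_def)
  moreover have "A \<notin> g ` C" if "A \<in> L" for A
    using near[of A] levelL[OF that] by auto
  then have "L \<inter> g ` C = {}"
    by blast
  ultimately have "card (L \<union> g ` C) = card L + card C"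
    using CL \<open>inj g\<close>
    by (simp add: card_Un_disjoint finite_subset card_image inj_on_subset)
  moreover have "card L = n choose k"
    by (simp add: L_def n_subsets)
  ultimately show ?thesis
    using le cardC by simp
qed

theorem theorem4:
  fixes n k :: nat
  assumes "n > 0" and "even n" and "k = n div 2"
  shows "La_N n \<ge> (n choose k) + max_code_size n 4 k"
  using assms(1) by (rule La_N_ge_level_plus_code)

end
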